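(* Let $\ell^{\infty}$ be the $C^{*}$-algebra of all bounded sequences of complex numbers and $\ell^{c}\subset\ell^{\infty}$ the $C^{*}$-subalgebra of all convergent sequences. Then $\ell^{c}$ is a totally non hereditary subalgebra of $\ell^{\infty}$; that is, there is no hereditary imbedding of $\ell^{c}$ into $\ell^{\infty}$ (equivalently, $\ell^{c}$ is not isomorphic to any hereditary $C^{*}$-subalgebra of $\ell^{\infty}$).
   Context: Both algebras carry pointwise operations and the supremum norm. A $C^{*}$-subalgebra $B$ of a $C^{*}$-algebra $A$ is hereditary if for every positive $b\in B$ and every $a\in A$ with $0\le a\le b$ we have $a\in B$. An injective $*$-homomorphism of $C^{*}$-algebras is called hereditary if its image is a hereditary subalgebra. A $C^{*}$-subalgebra $B$ of $A$ is called totally non hereditary if there is no hereditary imbedding of $B$ into $A$, equivalently if $B$ is not isomorphic to any hereditary subalgebra of $A$. *)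

theory Defs
  imports "HOL-Analysis.Analysis"
begin

section \<open>\<open>C\<^sup>*\<close>-algebras\<close>

text \<open>
  Algebras are not required to be unital. The real scalar multiplication inherited from
  \<^class>\<open>real_normed_algebra\<close> is the restriction of the complex one.
\<close>

class cstar_algebra = real_normed_algebra + banach +
  fixes cscale :: "complex \<Rightarrow> 'a \<Rightarrow> 'a"  (infixr \<open>*c\<close> 75)
    and adj :: "'a \<Rightarrow> 'a"
  assumes cscale_add_right: "c *c (x + y) = c *c x + c *c y"
    and cscale_add_left: "(c + d) *c x = c *c x + d *c x"
    and cscale_cscale: "c *c d *c x = (c * d) *c x"
    and cscale_of_real: "complex_of_real r *c x = r *\<^sub>R x"
    and cscale_mult_left: "(c *c x) * y = c *c (x * y)"
    and cscale_mult_right: "x * (c *c y) = c *c (x * y)"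
    and norm_cscale: "norm (c *c x) = cmod c * norm x"
    and adj_adj: "adj (adj x) = x"
    and adj_add: "adj (x + y) = adj x + adj y"
    and adj_cscale: "adj (c *c x) = cnj c *c adj x"
    and adj_mult: "adj (x * y) = adj y * adj x"
    and cstar_identity: "norm (adj x * x) = (norm x)\<^sup>2"

lemma norm_adj: "norm (adj x) = norm (x :: 'a :: cstar_algebra)"
proof -
  have le: "norm y \<le> norm (adj y)" for y :: 'a
  proof (cases "norm y = 0")
    case False
    have "norm y * norm y \<le> norm (adj y) * norm y"
      using norm_mult_ineq[of "adj y" y] by (simp add: cstar_identity power2_eq_square)
    with False show ?thesis
      by (simp add: mult_le_cancel_right)
  qed simp
  show ?thesis
    using le[of x] le[of "adj x"] by (simp add: adj_adj)
qed

lemma bounded_linear_adj: "bounded_linear (adj :: 'a \<Rightarrow> 'a :: cstar_algebra)"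
proof (rule bounded_linear_intro[where K = 1])
  fix r :: real and x :: 'a
  show "adj (r *\<^sub>R x) = r *\<^sub>R adj x"
    using adj_cscale[of "complex_of_real r" x] by (simp add: cscale_of_real)
qed (simp_all add: adj_add norm_adj)

lemma bounded_linear_cscale: "bounded_linear (\<lambda>x :: 'a :: cstar_algebra. c *c x)"
proof (rule bounded_linear_intro[where K = "cmod c"])
  fix r :: real and x :: 'a
  have "c *c complex_of_real r *c x = complex_of_real r *c c *c x"
    by (simp only: cscale_cscale mult.commute)
  then show "c *c (r *\<^sub>R x) = r *\<^sub>R (c *c x)"
    by (simp add: cscale_of_real)
qed (simp_all add: cscale_add_right norm_cscale)

definition cstar_subalgebra :: "'a :: cstar_algebra set \<Rightarrow> bool" where
  "cstar_subalgebra B \<longleftrightarrow>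
     0 \<in> B \<and>
     (\<forall>x\<in>B. \<forall>y\<in>B. x + y \<in> B) \<and>
     (\<forall>c. \<forall>x\<in>B. c *c x \<in> B) \<and>
     (\<forall>x\<in>B. \<forall>y\<in>B. x * y \<in> B) \<and>
     (\<forall>x\<in>B. adj x \<in> B) \<and>
     closed B"

definition cstar_positive :: "'a :: cstar_algebra \<Rightarrow> bool" where
  "cstar_positive a \<longleftrightarrow> (\<exists>x. a = adj x * x)"

definition cstar_le :: "'a :: cstar_algebra \<Rightarrow> 'a \<Rightarrow> bool" where
  "cstar_le a b \<longleftrightarrow> cstar_positive (b - a)"

definition hereditary_subalgebra :: "'a :: cstar_algebra set \<Rightarrow> bool" where
  "hereditary_subalgebra B \<longleftrightarrow>
     cstar_subalgebra B \<and>
     (\<forall>b\<in>B. cstar_positive b \<longrightarrow> (\<forall>a. cstar_le 0 a \<and> cstar_le a b \<longrightarrow> a \<in> B))"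

text \<open>
  A subalgebra is a \<open>C\<^sup>*\<close>-algebra in its own right; the values of a map outside of it are
  irrelevant. Homomorphisms need not preserve units.
\<close>

definition star_hom_on :: "'a :: cstar_algebra set \<Rightarrow> ('a \<Rightarrow> 'b :: cstar_algebra) \<Rightarrow> bool" where
  "star_hom_on B \<phi> \<longleftrightarrow>
     (\<forall>x\<in>B. \<forall>y\<in>B. \<phi> (x + y) = \<phi> x + \<phi> y) \<and>
     (\<forall>c. \<forall>x\<in>B. \<phi> (c *c x) = c *c \<phi> x) \<and>
     (\<forall>x\<in>B. \<forall>y\<in>B. \<phi> (x * y) = \<phi> x * \<phi> y) \<and>
     (\<forall>x\<in>B. \<phi> (adj x) = adj (\<phi> x))"

definition hereditary_imbedding ::
    "'a :: cstar_algebra set \<Rightarrow> ('a \<Rightarrow> 'b :: cstar_algebra) \<Rightarrow> bool" where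
  "hereditary_imbedding B \<phi> \<longleftrightarrow>
     star_hom_on B \<phi> \<and> inj_on \<phi> B \<and> hereditary_subalgebra (\<phi> ` B)"

definition star_isomorphic :: "'a :: cstar_algebra set \<Rightarrow> 'b :: cstar_algebra set \<Rightarrow> bool" where
  "star_isomorphic B C \<longleftrightarrow> (\<exists>\<phi>. star_hom_on B \<phi> \<and> bij_betw \<phi> B C)"

definition totally_non_hereditary :: "'a :: cstar_algebra set \<Rightarrow> bool" where
  "totally_non_hereditary B \<longleftrightarrow>
     cstar_subalgebra B \<and> \<not> (\<exists>\<phi> :: 'a \<Rightarrow> 'a. hereditary_imbedding B \<phi>)"


section \<open>Algebras of bounded continuous functions\<close>

instantiation complex :: cstar_algebra
begin

definition cscale_complex :: "complex \<Rightarrow> complex \<Rightarrow> complex" where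
  "cscale_complex c x = c * x"

definition adj_complex :: "complex \<Rightarrow> complex" where
  "adj_complex = cnj"

instance
  by standard
    (auto simp: cscale_complex_def adj_complex_def algebra_simps scaleR_conv_of_real
      norm_mult power2_eq_square)

end

unbundle bcontfun.lifting

instantiation bcontfun :: (topological_space, real_normed_algebra) real_normed_algebra
begin

lift_definition times_bcontfun :: "('a \<Rightarrow>\<^sub>C 'b) \<Rightarrow> ('a \<Rightarrow>\<^sub>C 'b) \<Rightarrow> 'a \<Rightarrow>\<^sub>C 'b"
  is "\<lambda>f g x. f x * g x"
proof -
  fix f g :: "'a \<Rightarrow> 'b"
  assume f: "f \<in> bcontfun" and g: "g \<in> bcontfun"
  obtain K where K: "norm (f x) \<le> K" for x
    using f by (auto simp: bcontfun_def bounded_iff)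
  obtain L where L: "norm (g x) \<le> L" for x
    using g by (auto simp: bcontfun_def bounded_iff)
  have "norm (f x * g x) \<le> K * L" for x
    using norm_mult_ineq[of "f x" "g x"] K[of x] L[of x]
    by (meson mult_mono norm_ge_zero order_trans)
  moreover have "continuous_on UNIV (\<lambda>x. f x * g x)"
    using f g by (auto simp: bcontfun_def intro!: continuous_intros)
  ultimately show "(\<lambda>x. f x * g x) \<in> bcontfun"
    by (rule bcontfun_normI[rotated])
qed

declare times_bcontfun.rep_eq [simp]

instance
proof
  fix f g h :: "'a \<Rightarrow>\<^sub>C 'b" and r :: real
  show "norm (f * g) \<le> norm f * norm g"
  proof (rule norm_bound)
    fix x
    show "norm (apply_bcontfun (f * g) x) \<le> norm f * norm g"
      using norm_mult_ineq[of "f x" "g x"] norm_bounded[of f x] norm_bounded[of g x]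
      by (simp, meson mult_mono norm_ge_zero order_trans)
  qed
qed (auto intro!: bcontfun_eqI simp: algebra_simps)

end

text \<open>
  The library has completeness only for metric domains, and \<^typ>\<open>nat\<close> is no instance of
  \<^class>\<open>metric_space\<close>.
\<close>

instance bcontfun :: (topological_space, complete_space) complete_space
proof
  fix f :: "nat \<Rightarrow> 'a \<Rightarrow>\<^sub>C 'b"
  assume "Cauchy f"
  then obtain g where "uniform_limit UNIV f g sequentially"
    using uniformly_convergent_eq_cauchy[of "\<lambda>_. True" f]
    unfolding Cauchy_def uniform_limit_sequentially_iff
    by (metis dist_fun_lt_imp_dist_val_lt)
  from uniform_limit_bcontfunE[OF this sequentially_bot]
  show "convergent f"
    by (metis convergentI)
qed

instance bcontfun :: (topological_space, banach) banach ..

instantiation bcontfun :: (topological_space, cstar_algebra) cstar_algebra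
begin

lift_definition cscale_bcontfun :: "complex \<Rightarrow> ('a \<Rightarrow>\<^sub>C 'b) \<Rightarrow> 'a \<Rightarrow>\<^sub>C 'b"
  is "\<lambda>c f x. c *c f x"
  by (auto simp: bcontfun_def image_image[symmetric]
      intro: bounded_linear.continuous_on[OF bounded_linear_cscale]
        bounded_linear_image[OF _ bounded_linear_cscale])

lift_definition adj_bcontfun :: "('a \<Rightarrow>\<^sub>C 'b) \<Rightarrow> 'a \<Rightarrow>\<^sub>C 'b"
  is "\<lambda>f x. adj (f x)"
  by (auto simp: bcontfun_def image_image[symmetric]
      intro: bounded_linear.continuous_on[OF bounded_linear_adj]
        bounded_linear_image[OF _ bounded_linear_adj])

declare cscale_bcontfun.rep_eq [simp] adj_bcontfun.rep_eq [simp]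

instance
proof
  fix c d :: complex and r :: real and f g :: "'a \<Rightarrow>\<^sub>C 'b"
  have le: "norm (c *c f) \<le> cmod c * norm f" for c and f :: "'a \<Rightarrow>\<^sub>C 'b"
    by (rule norm_bound) (simp add: norm_cscale norm_bounded mult_left_mono)
  show "norm (c *c f) = cmod c * norm f"
  proof (cases "c = 0")
    case True
    then show ?thesis using le[of c f] by simp
  next
    case False
    have "inverse c *c c *c f = f"
    proof (rule bcontfun_eqI)
      fix x
      show "(inverse c *c c *c f) x = f x"
        using False cscale_of_real[of 1 "f x"] by (simp add: cscale_cscale)
    qed
    then have "norm f \<le> norm (c *c f) / cmod c"
      using le[of "inverse c" "c *c f"] by (simp add: norm_inverse divide_inverse mult.commute)
    then have "cmod c * norm f \<le> norm (c *c f)"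
      using False by (simp add: field_simps)
    then show ?thesis using le[of c f] by simp
  qed
  show "norm (adj f * f) = (norm f)\<^sup>2"
  proof (rule antisym)
    show "norm (adj f * f) \<le> (norm f)\<^sup>2"
      by (rule norm_bound) (simp add: cstar_identity norm_bounded power_mono)
    have "norm f \<le> sqrt (norm (adj f * f))"
    proof (rule norm_bound)
      fix x
      have "(norm (f x))\<^sup>2 \<le> norm (adj f * f)"
        using norm_bounded[of "adj f * f" x] by (simp add: cstar_identity)
      then show "norm (f x) \<le> sqrt (norm (adj f * f))"
        by (rule real_le_rsqrt)
    qed
    then show "(norm f)\<^sup>2 \<le> norm (adj f * f)"
      using power_mono[of "norm f" "sqrt (norm (adj f * f))" 2] by simp
  qed
qed (auto intro!: bcontfun_eqI
      simp: cscale_add_right cscale_add_left cscale_cscale cscale_of_real cscale_mult_left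
        cscale_mult_right adj_adj adj_add adj_cscale adj_mult)

end

lifting_update bcontfun.lifting
lifting_forget bcontfun.lifting


section \<open>The sequence algebras\<close>

text \<open>
  As \<^typ>\<open>nat\<close> carries the discrete topology, every bounded sequence is a bounded continuous
  function, so \<^typ>\<open>nat \<Rightarrow>\<^sub>C complex\<close> with its pointwise operations and supremum norm is
  \<open>\<ell>\<^sup>\<infinity>\<close>.
\<close>

type_synonym ell_inf = "nat \<Rightarrow>\<^sub>C complex"

lemma bcontfun_nat: "(bcontfun :: (nat \<Rightarrow> complex) set) = {f. bounded (range f)}"
  by (auto simp: bcontfun_def)

lemma norm_ell_inf: "norm (f :: ell_inf) = (SUP n. cmod (f n))"
  by (simp add: norm_bcontfun_def dist_bcontfun.rep_eq)

definition ell_c :: "ell_inf set" where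
  "ell_c = {f. convergent (apply_bcontfun f)}"

lemma apply_bcontfun_ell_c: "apply_bcontfun ` ell_c = {f. convergent f}"
proof -
  have "f \<in> apply_bcontfun ` ell_c" if "convergent f" for f
  proof -
    have "f \<in> bcontfun"
      using that by (auto simp: bcontfun_nat convergent_def intro: convergent_imp_bounded)
    then show ?thesis
      using that by (auto simp: ell_c_def elim!: bcontfunE)
  qed
  then show ?thesis by (auto simp: ell_c_def)
qed

text \<open>On \<open>\<ell>\<^sup>\<infinity>\<close> the abstract order is the pointwise one.\<close>

lemma cstar_positive_ell_inf:
  "cstar_positive (f :: ell_inf) \<longleftrightarrow> (\<forall>n. f n \<in> \<real> \<and> 0 \<le> Re (f n))"
proof
  assume "cstar_positive f"
  then obtain g where g: "f = adj g * g"
    by (auto simp: cstar_positive_def)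
  have "f n = complex_of_real ((cmod (g n))\<^sup>2)" for n
    using complex_norm_square[of "g n"] by (simp add: g adj_complex_def mult.commute)
  then show "\<forall>n. f n \<in> \<real> \<and> 0 \<le> Re (f n)"
    by simp
next
  assume f: "\<forall>n. f n \<in> \<real> \<and> 0 \<le> Re (f n)"
  define g where "g = (\<lambda>n. complex_of_real (sqrt (Re (f n))))"
  have "cmod (g n) \<le> sqrt (norm f)" for n
    using f norm_bounded[of f n] abs_Re_le_cmod[of "f n"] by (simp add: g_def)
  then have "g \<in> bcontfun"
    by (auto simp: bcontfun_nat bounded_iff)
  then obtain h where h: "g = apply_bcontfun h"
    by (rule bcontfunE)
  have "f = adj h * h"
  proof (rule bcontfun_eqI)
    fix n
    have "f n = complex_of_real (Re (f n))"
      using f by simp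
    also have "\<dots> = cnj (g n) * g n"
      using f by (simp add: g_def flip: of_real_mult)
    finally show "f n = (adj h * h) n"
      by (simp add: h adj_complex_def)
  qed
  then show "cstar_positive f"
    by (auto simp: cstar_positive_def)
qed

end

theory Submission
  imports Defs
begin

text \<open>
  Let \<open>\<phi>\<close> be a hereditary imbedding and let \<open>Q\<^sub>n\<close> be the support of the idempotent
  \<open>\<phi> (\<delta>\<^sub>n)\<close>; these sets are nonempty, pairwise disjoint and contained in the support of \<open>\<phi> 1\<close>.
  By heredity the indicator of \<open>T = \<Union>n. Q\<^bsub>2n\<^esub>\<close>, which lies below \<open>\<phi> 1\<close>, is some \<open>\<phi> p\<close> with
  \<open>p\<close> convergent. As \<open>\<phi> (p \<delta>\<^sub>n)\<close> is \<open>\<phi> (\<delta>\<^sub>n)\<close> for even \<open>n\<close> and \<open>0\<close> for odd \<open>n\<close>, injectivity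
  forces \<open>p\<close> to be the sequence \<open>1, 0, 1, 0, \<dots>\<close>, which diverges.
\<close>

definition ell_indicator :: "nat set \<Rightarrow> ell_inf" where
  "ell_indicator A = Bcontfun (indicator A)"

lemma ell_indicator_apply [simp]: "ell_indicator A n = indicator A n"
proof -
  have "(indicator A :: nat \<Rightarrow> complex) \<in> bcontfun"
    by (auto simp: bcontfun_nat bounded_iff indicator_def intro!: exI[of _ 1])
  then show ?thesis
    by (simp add: ell_indicator_def Bcontfun_inverse)
qed

lemma ell_indicator_mult: "ell_indicator A * ell_indicator B = ell_indicator (A \<inter> B)"
  by (rule bcontfun_eqI) (simp add: indicator_inter_arith)

text \<open>Each value of \<open>q\<close> is a root of \<open>z * z = z\<close> in the field of
  complex numbers, hence 0 or 1.\<close>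

lemma ell_inf_idempotent:
  assumes "(q :: ell_inf) * q = q"
  shows "q = ell_indicator {k. q k \<noteq> 0}"
proof (rule bcontfun_eqI)
  fix k
  have "q k * q k = q k"
    using assms by (metis times_bcontfun.rep_eq)
  then show "q k = ell_indicator {k. q k \<noteq> 0} k"
    by (auto simp: indicator_def)
qed

lemma ell_indicator_le:
  assumes "A \<subseteq> B"
  shows "cstar_le (ell_indicator A) (ell_indicator B)"
  using assms by (auto simp: cstar_le_def cstar_positive_ell_inf indicator_def)

lemma ell_indicator_empty: "ell_indicator {} = 0"
  by (rule bcontfun_eqI) simp

text \<open>The only form in which heredity is used: a projection in \<open>C\<close> brings every
  smaller projection with it.\<close>

lemma hereditary_ell_indicator:
  assumes "hereditary_subalgebra C" "ell_indicator B \<in> C" "A \<subseteq> B"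
  shows "ell_indicator A \<in> C"
proof -
  have "cstar_le 0 (ell_indicator A)"
    using ell_indicator_le[of "{}" A] by (simp add: ell_indicator_empty)
  moreover have "cstar_positive (ell_indicator B)"
    by (auto simp: cstar_positive_ell_inf indicator_def)
  ultimately show ?thesis
    using assms ell_indicator_le unfolding hereditary_subalgebra_def by blast
qed

lemma ell_indicator_UNIV_in_ell_c: "ell_indicator UNIV \<in> ell_c"
proof -
  have "apply_bcontfun (ell_indicator UNIV) = (\<lambda>_. 1)"
    by (rule ext) simp
  then show ?thesis
    by (simp add: ell_c_def convergent_const)
qed

lemma ell_indicator_finite_in_ell_c:
  assumes "finite A"
  shows "ell_indicator A \<in> ell_c"
proof -
  have "\<forall>\<^sub>F k in sequentially. ell_indicator A k = 0"
    using assms by (auto simp: indicator_def cofinite_eq_sequentially[symmetric]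
        eventually_cofinite)
  then have "ell_indicator A \<longlonglongrightarrow> 0"
    by (rule tendsto_eventually)
  then show ?thesis
    by (auto simp: ell_c_def convergent_def)
qed

text \<open>An \<open>e / 3\<close> argument: a uniform limit of Cauchy sequences is Cauchy, and the
  complex numbers are complete.\<close>

lemma closed_ell_c: "closed ell_c"
proof (rule closed_limpt[THEN iffD2], intro allI impI)
  fix f :: ell_inf
  assume f: "f islimpt ell_c"
  have "Cauchy (apply_bcontfun f)"
  proof (rule metric_CauchyI)
    fix e :: real
    assume "0 < e"
    then obtain g where g: "g \<in> ell_c" "dist g f < e / 3"
      using f unfolding islimpt_approachable by (metis divide_pos_pos zero_less_numeral)
    have near: "dist (f n) (g n) < e / 3" for n
      using dist_bounded[of f n g] g(2) by (simp add: dist_commute)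
    have "Cauchy (apply_bcontfun g)"
      using g(1) by (simp add: ell_c_def convergent_Cauchy)
    then obtain M where M: "\<And>m n. m \<ge> M \<Longrightarrow> n \<ge> M \<Longrightarrow> dist (g m) (g n) < e / 3"
      using \<open>0 < e\<close> unfolding Cauchy_def by (metis divide_pos_pos zero_less_numeral)
    have "dist (f m) (f n) < e" if "m \<ge> M" "n \<ge> M" for m n
      using near[of m] near[of n] M[OF that]
        dist_triangle[of "f m" "f n" "g m"] dist_triangle[of "g m" "f n" "g n"]
      by (simp add: dist_commute)
    then show "\<exists>M. \<forall>m\<ge>M. \<forall>n\<ge>M. dist (f m) (f n) < e"
      by blast
  qed
  then show "f \<in> ell_c"
    by (simp add: ell_c_def Cauchy_convergent)
qed

lemma cstar_subalgebra_ell_c: "cstar_subalgebra ell_c"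
proof -
  have adj: "adj f \<in> ell_c" if "f \<in> ell_c" for f
  proof -
    obtain l where "f \<longlonglongrightarrow> l"
      using \<open>f \<in> ell_c\<close> by (auto simp: ell_c_def convergent_def)
    then have "(\<lambda>n. adj f n) \<longlonglongrightarrow> cnj l"
      by (simp add: adj_complex_def tendsto_cnj)
    then show ?thesis
      by (auto simp: ell_c_def convergent_def)
  qed
  have eqs: "apply_bcontfun 0 = (\<lambda>n. 0)" "apply_bcontfun (f + g) = (\<lambda>n. f n + g n)"
    "apply_bcontfun (f * g) = (\<lambda>n. f n * g n)" for f g :: ell_inf
    by auto
  show ?thesis
    unfolding cstar_subalgebra_def
    by (auto simp: adj closed_ell_c)
      (auto simp: ell_c_def eqs cscale_complex_def convergent_const convergent_add convergent_mult)
qed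

text \<open>The subsequences at even and at odd positions are constantly 1 and constantly 0.\<close>

lemma not_convergent_even_indicator:
  "\<not> convergent (indicator {n. even n} :: nat \<Rightarrow> complex)"
proof
  assume "convergent (indicator {n. even n} :: nat \<Rightarrow> complex)"
  then obtain l where l: "(indicator {n. even n} :: nat \<Rightarrow> complex) \<longlonglongrightarrow> l"
    by (auto simp: convergent_def)
  have "(\<lambda>n. indicator {n. even n} (2 * n) :: complex) \<longlonglongrightarrow> l"
    by (rule filterlim_compose[OF l]) (auto intro!: filterlim_subseq strict_monoI)
  moreover have "(\<lambda>n. indicator {n. even n} (2 * n + 1) :: complex) \<longlonglongrightarrow> l"
    by (rule filterlim_compose[OF l]) (auto intro!: filterlim_subseq strict_monoI)
  ultimately have "l = 1" "l = 0"
    by (simp_all add: LIMSEQ_const_iff)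
  then show False
    by simp
qed

lemma no_hereditary_imbedding_ell_c:
  fixes \<phi> :: "ell_inf \<Rightarrow> ell_inf"
  shows "\<not> hereditary_imbedding ell_c \<phi>"
proof
  assume "hereditary_imbedding ell_c \<phi>"
  then have hom: "star_hom_on ell_c \<phi>" and inj: "inj_on \<phi> ell_c"
    and her: "hereditary_subalgebra (\<phi> ` ell_c)"
    by (auto simp: hereditary_imbedding_def)
  have mult: "\<phi> (f * g) = \<phi> f * \<phi> g" if "f \<in> ell_c" "g \<in> ell_c" for f g
    using hom that by (auto simp: star_hom_on_def)
  have zero_in: "0 \<in> ell_c"
    using cstar_subalgebra_ell_c by (simp add: cstar_subalgebra_def)
  have mult_in: "f * g \<in> ell_c" if "f \<in> ell_c" "g \<in> ell_c" for f g
    using cstar_subalgebra_ell_c that by (auto simp: cstar_subalgebra_def)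
  have zero: "\<phi> 0 = 0"
  proof -
    have "\<phi> (0 + 0) = \<phi> 0 + \<phi> 0"
      using hom zero_in unfolding star_hom_on_def by blast
    then show ?thesis
      by simp
  qed
  define Q where "Q A = {k. \<phi> (ell_indicator A) k \<noteq> 0}" for A
  \<comment> \<open>Indicators are idempotent and \<open>\<phi>\<close> is multiplicative, so their
    images are again indicators.\<close>
  have Q: "\<phi> (ell_indicator A) = ell_indicator (Q A)" if "ell_indicator A \<in> ell_c" for A
    unfolding Q_def
    by (rule ell_inf_idempotent) (simp add: ell_indicator_mult flip: mult[OF that that])
  note fin = ell_indicator_finite_in_ell_c
  have Q_le: "Q {n} \<subseteq> Q UNIV" for n
  proof -
    have "\<phi> (ell_indicator {n}) = \<phi> (ell_indicator {n}) * \<phi> (ell_indicator UNIV)"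
      using mult[OF fin ell_indicator_UNIV_in_ell_c, of "{n}"] by (simp add: ell_indicator_mult)
    then have "\<phi> (ell_indicator {n}) k = \<phi> (ell_indicator {n}) k * \<phi> (ell_indicator UNIV) k" for k
      by (metis times_bcontfun.rep_eq)
    then show ?thesis
      unfolding Q_def using mult_not_zero by (metis (mono_tags, lifting) Collect_mono)
  qed
  have Q_disjoint: "Q {m} \<inter> Q {n} = {}" if "m \<noteq> n" for m n
  proof -
    have "\<phi> (ell_indicator {m}) * \<phi> (ell_indicator {n}) = 0"
      using that mult[OF fin fin, of "{m}" "{n}"]
      by (simp add: ell_indicator_mult ell_indicator_empty zero)
    then have "\<phi> (ell_indicator {m}) k * \<phi> (ell_indicator {n}) k = 0" for k
      by (metis times_bcontfun.rep_eq zero_bcontfun.rep_eq)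
    then show ?thesis
      by (auto simp: Q_def)
  qed
  define T where "T = (\<Union>n\<in>{n. even n}. Q {n})"
  \<comment> \<open>\<open>\<phi>\<close> need not preserve the unit, so the upper bound for
    \<open>T\<close> is \<open>Q UNIV\<close> rather than \<open>UNIV\<close>.\<close>
  have "ell_indicator (Q UNIV) \<in> \<phi> ` ell_c"
    using Q ell_indicator_UNIV_in_ell_c by (metis imageI)
  then have "ell_indicator T \<in> \<phi> ` ell_c"
    by (rule hereditary_ell_indicator[OF her]) (use Q_le in \<open>auto simp: T_def\<close>)
  then obtain p where p: "p \<in> ell_c" "\<phi> p = ell_indicator T"
    by auto
  have "p n = indicator {n. even n} n" for n
  proof -
    \<comment> \<open>Multiplying by \<open>ell_indicator {n}\<close> isolates the coordinate
      \<open>p n\<close>. Both this product and the element it is compared with lie in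
      \<open>ell_c\<close>, where \<open>\<phi>\<close> is injective.\<close>
    have "\<phi> (p * ell_indicator {n}) = ell_indicator (T \<inter> Q {n})"
      by (simp add: mult p fin Q ell_indicator_mult)
    also have "T \<inter> Q {n} = (if even n then Q {n} else {})"
      unfolding T_def using Q_disjoint by (auto; metis disjoint_iff)
    also have "ell_indicator \<dots> = \<phi> (if even n then ell_indicator {n} else 0)"
      by (simp add: Q fin ell_indicator_empty zero)
    finally have "p * ell_indicator {n} = (if even n then ell_indicator {n} else 0)"
      by (rule inj_onD[OF inj]) (auto simp: mult_in p fin zero_in)
    then have "(p * ell_indicator {n}) n = (if even n then ell_indicator {n} else 0) n"
      by simp
    then show ?thesis
      by (simp split: if_splits)
  qed
  then have "apply_bcontfun p = indicator {n. even n}"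
    by (rule ext)
  with p(1) show False
    using not_convergent_even_indicator by (simp add: ell_c_def)
qed

theorem corollary4:
  shows "totally_non_hereditary ell_c \<and>
    \<not> (\<exists>C :: ell_inf set. hereditary_subalgebra C \<and> star_isomorphic ell_c C)"
proof
  show "totally_non_hereditary ell_c"
    using cstar_subalgebra_ell_c no_hereditary_imbedding_ell_c
    by (auto simp: totally_non_hereditary_def)
  \<comment> \<open>An isomorphism onto a hereditary \<open>C\<close> has image \<open>C\<close>, so
    it would be a hereditary imbedding.\<close>
  show "\<not> (\<exists>C :: ell_inf set. hereditary_subalgebra C \<and> star_isomorphic ell_c C)"
    using no_hereditary_imbedding_ell_c
    unfolding star_isomorphic_def hereditary_imbedding_def bij_betw_def by blast
qed

end
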